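(* Let $G$ be a graph with $n$ vertices and treewidth at most $w$, with two designated terminal vertices. Then $G$ can be reduced (transformed until only the two terminals remain, joined by at most a single edge) using $O(w^2 n)$ parallel reductions and $O(n)$ star-mesh transformations, each of degree at most $w+1$, where no terminal vertex is ever deleted.
   Context: A parallel reduction replaces two parallel edges between the same pair of vertices by a single edge. A $k$-star-mesh transformation (of degree $k$) deletes a vertex $c$ of degree $k$ with neighbors $v_1,\dots,v_k$ together with its incident edges, and adds an edge $v_iv_j$ for every pair $i<j$ (this may create parallel edges). Terminals may not be deleted by a star-mesh transformation. *)

theory Defs
  imports "HOL-Library.Multiset"
begin

text \<open>Undirected loopless multigraphs: an edge is the two-element set of its endpoints, and
  parallel edges are repeated occurrences of the same set in the multiset of edges.\<close>

record 'a mgraph =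
  verts :: "'a set"
  edges :: "'a set multiset"

definition multigraph :: "'a mgraph \<Rightarrow> bool" where
  "multigraph G \<longleftrightarrow> finite (verts G) \<and> (\<forall>e \<in># edges G. e \<subseteq> verts G \<and> card e = 2)"

definition simple_graph :: "'a mgraph \<Rightarrow> bool" where
  "simple_graph G \<longleftrightarrow> multigraph G \<and> (\<forall>e. count (edges G) e \<le> 1)"

definition adj :: "'a mgraph \<Rightarrow> 'a \<Rightarrow> 'a \<Rightarrow> bool" where
  "adj G u v \<longleftrightarrow> {u, v} \<in># edges G"

definition neighbors :: "'a mgraph \<Rightarrow> 'a \<Rightarrow> 'a set" where
  "neighbors G c = {v. adj G c v}"

definition degree :: "'a mgraph \<Rightarrow> 'a \<Rightarrow> nat" where
  "degree G c = size {#e \<in># edges G. c \<in> e#}"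

definition induced_subgraph :: "'a mgraph \<Rightarrow> 'a set \<Rightarrow> 'a mgraph" where
  "induced_subgraph G S = \<lparr>verts = verts G \<inter> S, edges = {#e \<in># edges G. e \<subseteq> S#}\<rparr>"

definition connected_graph :: "'a mgraph \<Rightarrow> bool" where
  "connected_graph G \<longleftrightarrow>
     verts G \<noteq> {} \<and> (\<forall>u \<in> verts G. \<forall>v \<in> verts G. (adj G)\<^sup>*\<^sup>* u v)"

definition cycle :: "'a mgraph \<Rightarrow> 'a list \<Rightarrow> bool" where
  "cycle G vs \<longleftrightarrow> length vs \<ge> 3 \<and> distinct vs \<and>
     (\<forall>i < length vs. adj G (vs ! i) (vs ! (Suc i mod length vs)))"

definition tree :: "'a mgraph \<Rightarrow> bool" where
  "tree T \<longleftrightarrow> simple_graph T \<and> connected_graph T \<and> (\<nexists>vs. cycle T vs)"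

definition tree_decomposition :: "'a mgraph \<Rightarrow> 'b mgraph \<Rightarrow> ('b \<Rightarrow> 'a set) \<Rightarrow> bool" where
  "tree_decomposition G T B \<longleftrightarrow>
     tree T \<and>
     (\<Union>t \<in> verts T. B t) = verts G \<and>
     (\<forall>e \<in># edges G. \<exists>t \<in> verts T. e \<subseteq> B t) \<and>
     (\<forall>v \<in> verts G. connected_graph (induced_subgraph T {t. v \<in> B t}))"

text \<open>The subtraction is on natural numbers; it truncates only when every bag is empty, that is,
  for the graph without vertices.\<close>

definition width :: "'b mgraph \<Rightarrow> ('b \<Rightarrow> 'a set) \<Rightarrow> nat" where
  "width T B = Max ((\<lambda>t. card (B t)) ` verts T) - 1"

text \<open>Trees are finite, so it is no restriction to take their nodes among the natural numbers.
  The minimum exists for every finite graph, because of the decomposition with a single bag.\<close>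

definition treewidth :: "'a mgraph \<Rightarrow> nat" where
  "treewidth G =
     (LEAST k. \<exists>(T :: nat mgraph) B. tree_decomposition G T B \<and> width T B = k)"

definition parallel_reduction :: "'a mgraph \<Rightarrow> 'a mgraph \<Rightarrow> bool" where
  "parallel_reduction G H \<longleftrightarrow>
     (\<exists>e. {#e, e#} \<subseteq># edges G \<and>
          H = \<lparr>verts = verts G, edges = edges G - {#e, e#} + {#e#}\<rparr>)"

text \<open>Requiring both the degree and the number of neighbors to be \<open>k\<close> excludes parallel edges at
  the deleted vertex \<open>c\<close>. The case \<open>k = 0\<close> deletes an isolated vertex, the case \<open>k = 1\<close> a pendant one.\<close>

definition star_mesh :: "nat \<Rightarrow> 'a \<Rightarrow> 'a mgraph \<Rightarrow> 'a mgraph \<Rightarrow> bool" where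
  "star_mesh k c G H \<longleftrightarrow>
     c \<in> verts G \<and> degree G c = k \<and> card (neighbors G c) = k \<and>
     H = \<lparr>verts = verts G - {c},
          edges = {#e \<in># edges G. c \<notin> e#} +
            mset_set {{u, v} | u v. u \<in> neighbors G c \<and> v \<in> neighbors G c \<and> u \<noteq> v}\<rparr>"

text \<open>\<open>reduces S d G p q H\<close>: the graph \<open>G\<close> can be transformed into \<open>H\<close> by exactly \<open>p\<close> parallel
  reductions and \<open>q\<close> star-mesh transformations, in any order, where each star-mesh transformation
  has degree at most \<open>d\<close> and does not delete a vertex of the terminal set \<open>S\<close>.\<close>

inductive reduces ::
  "'a set \<Rightarrow> nat \<Rightarrow> 'a mgraph \<Rightarrow> nat \<Rightarrow> nat \<Rightarrow> 'a mgraph \<Rightarrow> bool"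
  for S :: "'a set" and d :: nat and G :: "'a mgraph"
where
  refl: "reduces S d G 0 0 G"
| parallel: "reduces S d G p q H \<Longrightarrow> parallel_reduction H H' \<Longrightarrow> reduces S d G (Suc p) q H'"
| star: "reduces S d G p q H \<Longrightarrow> c \<notin> S \<Longrightarrow> k \<le> d \<Longrightarrow> star_mesh k c H H' \<Longrightarrow>
    reduces S d G p (Suc q) H'"

end

theory Submission imports Defs begin

text \<open>Root the tree of a tree decomposition at a node whose bag contains \<open>t\<close>, and eliminate the
  nonterminal vertices in the order of decreasing depth of their topmost bag. Every remaining neighbor
  of the eliminated vertex other than \<open>s\<close> lies in its topmost bag, so the degree is at most
  \<open>w + 1\<close>, and the new edges that avoid \<open>s\<close> again join vertices of a common bag; \<open>t\<close> may be kept
  to the end because its depth is zero.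
  Removing the parallel edges after each elimination costs at most \<open>2 * w\<^sup>2\<close> reductions.\<close>

section \<open>Adjacency, paths and cycles in multigraphs\<close>

lemma adj_sym: "adj G u v \<longleftrightarrow> adj G v u"
  by (simp add: adj_def insert_commute)

lemma adj_verts:
  assumes "multigraph G" "adj G u v"
  shows "u \<in> verts G" "v \<in> verts G" "u \<noteq> v"
proof -
  have "{u, v} \<subseteq> verts G \<and> card {u, v} = 2"
    using assms unfolding multigraph_def adj_def by blast
  then show "u \<in> verts G" "v \<in> verts G" "u \<noteq> v" by auto
qed

lemma neighbors_subset: "multigraph G \<Longrightarrow> neighbors G c \<subseteq> verts G - {c}"
  using adj_verts[of G c] by (auto simp: neighbors_def)

lemma finite_neighbors: "multigraph G \<Longrightarrow> finite (neighbors G c)"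
  using neighbors_subset[of G c] by (auto simp: multigraph_def intro: finite_subset)

text \<open>If \<open>x\<close> already occurs on the path from its successor, the part of that path
  starting at \<open>x\<close> serves instead; otherwise \<open>x\<close> is prepended.\<close>

lemma rtranclp_distinct_path:
  assumes "R\<^sup>*\<^sup>* x y"
  shows "\<exists>vs. vs \<noteq> [] \<and> hd vs = x \<and> last vs = y \<and> distinct vs \<and> successively R vs"
  using assms
proof (induction rule: converse_rtranclp_induct)
  case base
  show ?case by (rule exI[of _ "[y]"]) simp
next
  case (step x z)
  then obtain vs where vs: "vs \<noteq> []" "hd vs = z" "last vs = y" "distinct vs" "successively R vs"
    by blast
  show ?case
  proof (cases "x \<in> set vs")
    case True
    then obtain us ws where "vs = us @ x # ws" by (meson split_list)
    with vs have "last (x # ws) = y" "distinct (x # ws)" "successively R (x # ws)"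
      by (auto simp: successively_append_iff)
    then show ?thesis by (intro exI[of _ "x # ws"]) simp
  next
    case False
    with vs step.hyps(1) show ?thesis
      by (intro exI[of _ "x # vs"]) (auto simp: successively_Cons)
  qed
qed

text \<open>A distinct path from \<open>x\<close> to \<open>y\<close> inside \<open>A\<close> misses
  \<open>z\<close>, so putting \<open>z\<close> in front closes it to a cycle; its length is at
  least three because \<open>x \<noteq> y\<close>. In a tree this forces a new node to have only one
  neighbor among the nodes already reached.\<close>

lemma cycle_if_two_neighbors:
  assumes xy: "(\<lambda>u v. adj G u v \<and> u \<in> A \<and> v \<in> A)\<^sup>*\<^sup>* x y" "x \<noteq> y" "x \<in> A"
    and z: "z \<notin> A" "adj G z x" "adj G z y"
  shows "\<exists>vs. cycle G vs"
proof -
  let ?R = "\<lambda>u v. adj G u v \<and> u \<in> A \<and> v \<in> A"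
  obtain vs where vs: "vs \<noteq> []" "hd vs = x" "last vs = y" "distinct vs" "successively ?R vs"
    using rtranclp_distinct_path[OF xy(1)] by blast
  obtain vs' where vs': "vs = x # vs'" using vs(1,2) by (cases vs) auto
  then have "vs' \<noteq> []" using vs(3) xy(2) by auto
  have step: "?R (vs ! i) (vs ! Suc i)" if "Suc i < length vs" for i
    using vs(5) that by (auto simp: successively_conv_nth)
  have "set vs \<subseteq> A"
  proof
    fix v assume "v \<in> set vs"
    then obtain i where i: "i < length vs" "v = vs ! i" by (auto simp: in_set_conv_nth)
    show "v \<in> A"
    proof (cases i)
      case 0 then show ?thesis using i vs' xy(3) by simp
    next
      case (Suc j) then show ?thesis using step[of j] i by simp
    qed
  qed
  then have "distinct (z # vs)" using vs(4) z(1) by auto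
  moreover have "3 \<le> length (z # vs)" using vs' \<open>vs' \<noteq> []\<close> by (cases vs') auto
  moreover have "adj G ((z # vs) ! i) ((z # vs) ! (Suc i mod length (z # vs)))"
    if i: "i < length (z # vs)" for i
  proof -
    \<comment> \<open>The edges of the cycle are the one from \<open>z\<close> to \<open>x\<close>,
      the wrap-around edge from \<open>y\<close> back to \<open>z\<close>, and the steps of the path
      with indices shifted by one.\<close>
    consider "i = 0" | "i = length vs" | j where "i = Suc j" "Suc j < length vs"
      using i by (cases i) (auto simp: less_Suc_eq)
    then show ?thesis
    proof cases
      case 1 then show ?thesis using vs' z(2) by simp
    next
      case 2
      then have "(z # vs) ! i = y" using vs(1,3) by (simp add: last_conv_nth nth_Cons')
      then show ?thesis using 2 z(3) by (simp add: adj_sym)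
    next
      case 3 then show ?thesis using step[of j] by simp
    qed
  qed
  ultimately show ?thesis unfolding cycle_def by blast
qed

section \<open>Rooted trees and their connected subtrees\<close>

text \<open>The set \<open>A\<close> is the part of the tree reached so far, so that the rooting can
  be built node by node. The values of \<open>par\<close> at \<open>r\<close> and outside
  \<open>A\<close> are arbitrary.\<close>

definition rooting ::
  "'b mgraph \<Rightarrow> 'b \<Rightarrow> 'b set \<Rightarrow> ('b \<Rightarrow> 'b) \<Rightarrow> ('b \<Rightarrow> nat) \<Rightarrow> bool" where
  "rooting T r A par dep \<longleftrightarrow> r \<in> A \<and> dep r = 0 \<and>
     (\<forall>x \<in> A. (\<lambda>u v. adj T u v \<and> u \<in> A \<and> v \<in> A)\<^sup>*\<^sup>* r x) \<and>
     (\<forall>x \<in> A. \<forall>y \<in> A. adj T x y \<longrightarrow>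
        par y = x \<and> dep y = Suc (dep x) \<or> par x = y \<and> dep x = Suc (dep y))"

text \<open>A second neighbor of \<open>z\<close> in \<open>A\<close> would be connected to
  \<open>x\<close> inside \<open>A\<close> through \<open>r\<close>, which gives a cycle. So the new
  values at \<open>z\<close> have to respect only the edge between \<open>x\<close> and
  \<open>z\<close>.\<close>

lemma rooting_extend:
  assumes T: "multigraph T" "\<nexists>vs. cycle T vs" and rt: "rooting T r A par dep"
    and x: "x \<in> A" and z: "z \<notin> A" "adj T x z"
  shows "rooting T r (insert z A) (par(z := x)) (dep(z := Suc (dep x)))"
    (is "rooting T r _ ?p ?d")
proof -
  let ?R = "\<lambda>A u v. adj T u v \<and> u \<in> A \<and> v \<in> A"
  have only: "y = x" if y: "y \<in> A" "adj T z y" for y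
  proof (rule ccontr)
    assume "y \<noteq> x"
    have rx: "(?R A)\<^sup>*\<^sup>* r x" and ry: "(?R A)\<^sup>*\<^sup>* r y"
      using rt x y by (auto simp: rooting_def)
    have "symp (?R A)" by (auto simp: symp_def adj_sym)
    then have "(?R A)\<^sup>*\<^sup>* x r" using rx by (rule sympD[OF symp_rtranclp])
    then have "(?R A)\<^sup>*\<^sup>* x y" using ry by (rule rtranclp_trans)
    then show False
      using cycle_if_two_neighbors[of T A x y z] \<open>y \<noteq> x\<close> x z y T(2) by (auto simp: adj_sym)
  qed
  have mono: "(?R (insert z A))\<^sup>*\<^sup>* r y" if "y \<in> A" for y
  proof -
    have "(?R A)\<^sup>*\<^sup>* r y" using rt that by (auto simp: rooting_def)
    then show ?thesis by (rule rtranclp_mono[THEN predicate2D, rotated]) auto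
  qed
  have "(?R (insert z A))\<^sup>*\<^sup>* r z"
    using mono[OF x] x z by (auto intro: rtranclp.rtrancl_into_rtrancl)
  moreover have "?p b = a \<and> ?d b = Suc (?d a) \<or> ?p a = b \<and> ?d a = Suc (?d b)"
    if ab: "a \<in> insert z A" "b \<in> insert z A" "adj T a b" for a b
  proof -
    have "a \<noteq> b" using adj_verts(3)[OF T(1) ab(3)] .
    moreover have "b = x" if "a = z" using only[of b] ab that \<open>a \<noteq> b\<close> by auto
    moreover have "a = x" if "b = z"
      using only[of a] ab that \<open>a \<noteq> b\<close> by (auto simp: adj_sym[of T z])
    moreover have "par b = a \<and> dep b = Suc (dep a) \<or> par a = b \<and> dep a = Suc (dep b)"
      if "a \<in> A" "b \<in> A" using rt ab(3) that unfolding rooting_def by blast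
    ultimately show ?thesis using ab(1,2) by (cases "a = z"; cases "b = z") auto
  qed
  moreover have "r \<in> A" "?d r = 0" using rt z(1) by (auto simp: rooting_def)
  ultimately show ?thesis
    unfolding rooting_def by (blast intro: mono)
qed

text \<open>Starting from \<open>{r}\<close>, the reached part grows by one node at a time until it
  is the whole tree; \<open>n\<close> counts the reached nodes other than \<open>r\<close>.\<close>

lemma tree_rooting:
  assumes T: "tree T" and r: "r \<in> verts T"
  shows "\<exists>par dep. rooting T r (verts T) par dep"
proof -
  have mg: "multigraph T" and acyc: "\<nexists>vs. cycle T vs" and con: "connected_graph T"
    and fin: "finite (verts T)"
    using T by (auto simp: tree_def simple_graph_def multigraph_def)
  have "\<exists>A par dep. A \<subseteq> verts T \<and> card A = Suc n \<and> rooting T r A par dep"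
    if "Suc n \<le> card (verts T)" for n
    using that
  proof (induction n)
    case 0
    have "\<not> adj T r r" using adj_verts(3)[OF mg] by blast
    then show ?case using r
      by (intro exI[of _ "{r}"] exI[of _ id] exI[of _ "\<lambda>_. 0"]) (auto simp: rooting_def)
  next
    case (Suc n)
    then obtain A par dep where A: "A \<subseteq> verts T" "card A = Suc n" "rooting T r A par dep"
      by auto
    have rA: "r \<in> A" using A(3) by (simp add: rooting_def)
    have "A \<noteq> verts T" using A(2) Suc.prems by auto
    then obtain y where y: "y \<in> verts T" "y \<notin> A" using A(1) by blast
    have "(adj T)\<^sup>*\<^sup>* r y" using con r y by (auto simp: connected_graph_def)
    \<comment> \<open>A path from \<open>r\<close>, which lies in \<open>A\<close>, to a node
      outside \<open>A\<close> has an edge that leaves \<open>A\<close>.\<close>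
    then have "y \<in> A \<or> (\<exists>x z. x \<in> A \<and> z \<notin> A \<and> adj T x z)"
      by (induction rule: rtranclp_induct) (use rA in auto)
    then obtain x z where xz: "x \<in> A" "z \<notin> A" "adj T x z" using y by blast
    have "rooting T r (insert z A) (par(z := x)) (dep(z := Suc (dep x)))"
      by (rule rooting_extend[OF mg acyc A(3) xz])
    moreover have "card (insert z A) = Suc (Suc n)"
      using A xz fin by (simp add: finite_subset)
    moreover have "insert z A \<subseteq> verts T" using A xz adj_verts(2)[OF mg xz(3)] by auto
    ultimately show ?case by blast
  qed
  moreover have "card (verts T) > 0" using r fin by (auto simp: card_gt_0_iff)
  ultimately obtain A par dep where
    "A \<subseteq> verts T" "card A = card (verts T)" "rooting T r A par dep"
    by (metis Suc_pred order_refl)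
  then show ?thesis using card_subset_eq[OF fin] by metis
qed

text \<open>Induction along a path from \<open>a\<close> inside the subtree: a step to a child
  prepends one node to the chain of parents leading to \<open>a\<close>, and a step to the parent
  drops the first one. Since \<open>a\<close> has least depth, no difference of depths is
  truncated.\<close>

lemma connected_ancestor:
  assumes rt: "rooting T r (verts T) par dep" and mg: "multigraph T"
    and con: "connected_graph (induced_subgraph T S)"
    and a: "a \<in> verts T \<inter> S" "\<And>x. x \<in> verts T \<inter> S \<Longrightarrow> dep a \<le> dep x"
    and y: "y \<in> verts T \<inter> S"
  shows "(par ^^ (dep y - dep a)) y = a"
    and "i \<le> dep y - dep a \<Longrightarrow> (par ^^ i) y \<in> verts T \<inter> S"
proof -
  have "(adj (induced_subgraph T S))\<^sup>*\<^sup>* a y"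
    using con a y by (auto simp: connected_graph_def induced_subgraph_def)
  then have "y \<in> verts T \<inter> S \<and> (par ^^ (dep y - dep a)) y = a \<and>
    (\<forall>i \<le> dep y - dep a. (par ^^ i) y \<in> verts T \<inter> S)"
  proof (induction rule: rtranclp_induct)
    case base
    then show ?case using a by simp
  next
    case (step y z)
    have yz: "adj T y z" "z \<in> S" using step.hyps(2)
      by (auto simp: adj_def induced_subgraph_def)
    then have z: "z \<in> verts T \<inter> S" and yT: "y \<in> verts T" using adj_verts[OF mg] by auto
    have y': "(par ^^ (dep y - dep a)) y = a"
      "\<And>i. i \<le> dep y - dep a \<Longrightarrow> (par ^^ i) y \<in> verts T \<inter> S"
      using step.IH by auto
    have dep: "dep a \<le> dep y" "dep a \<le> dep z" using a(2) z step.IH by auto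
    have "par z = y \<and> dep z = Suc (dep y) \<or> par y = z \<and> dep y = Suc (dep z)"
      using rt yz z yT unfolding rooting_def by blast
    then show ?case
    proof
      assume par: "par z = y \<and> dep z = Suc (dep y)"
      then have eq: "dep z - dep a = Suc (dep y - dep a)" using dep by simp
      have "(par ^^ i) z \<in> verts T \<inter> S" if "i \<le> dep z - dep a" for i
        using that par z y'(2) eq by (cases i) (auto simp: funpow_Suc_right simp del: funpow.simps)
      then show ?thesis using z par y'(1) eq
        by (auto simp: funpow_Suc_right simp del: funpow.simps)
    next
      assume par: "par y = z \<and> dep y = Suc (dep z)"
      then have eq: "dep y - dep a = Suc (dep z - dep a)" using dep by simp
      have shift: "(par ^^ Suc i) y = (par ^^ i) z" for i
        using par by (simp add: funpow_Suc_right del: funpow.simps)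
      have "(par ^^ i) z \<in> verts T \<inter> S" if "i \<le> dep z - dep a" for i
        using that y'(2)[of "Suc i"] eq unfolding shift by simp
      then show ?thesis using z y'(1) unfolding eq shift by auto
    qed
  qed
  then show "(par ^^ (dep y - dep a)) y = a"
    and "i \<le> dep y - dep a \<Longrightarrow> (par ^^ i) y \<in> verts T \<inter> S" by auto
qed

section \<open>An elimination order from a tree decomposition\<close>

text \<open>In the application \<open>R\<close> relates the vertices with a common bag, \<open>f\<close> is the depth of the
  topmost bag, and \<open>X v\<close> is the topmost bag of \<open>v\<close> without \<open>v\<close>. Since \<open>R\<close> concerns the original
  graph, it stays fixed during the elimination.\<close>

definition elimination_order ::
  "'a set \<Rightarrow> nat \<Rightarrow> ('a \<Rightarrow> 'a \<Rightarrow> bool) \<Rightarrow> ('a \<Rightarrow> nat) \<Rightarrow> ('a \<Rightarrow> 'a set) \<Rightarrow> bool" where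
  "elimination_order V w R f X \<longleftrightarrow>
    (\<forall>v \<in> V. finite (X v) \<and> card (X v) \<le> w \<and>
      (\<forall>u \<in> V. u \<noteq> v \<and> R u v \<and> f u \<le> f v \<longrightarrow> u \<in> X v) \<and>
      (\<forall>u \<in> X v. \<forall>u' \<in> X v. R u u'))"

text \<open>If \<open>u\<close> and \<open>v\<close> share the bag of a node \<open>x\<close>, then
  \<open>top u\<close> and \<open>top v\<close> are both ancestors of \<open>x\<close>. When
  \<open>top v\<close> is at least as deep as \<open>top u\<close>, it lies on the chain from
  \<open>x\<close> up to \<open>top u\<close>, hence in the subtree of \<open>u\<close>, so the
  topmost bag of \<open>v\<close> contains \<open>u\<close>.\<close>

lemma tree_decomposition_elimination:
  fixes G :: "'a mgraph"
  assumes td: "tree_decomposition G T B" and w: "\<And>x. x \<in> verts T \<Longrightarrow> card (B x) \<le> w + 1"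
    and mg: "multigraph G" and t: "t \<in> verts G"
  obtains R and f :: "'a \<Rightarrow> nat" and X
  where "\<And>u v. adj G u v \<Longrightarrow> R u v" "f t = 0" "elimination_order (verts G) w R f X"
proof -
  have T: "tree T" and BV: "(\<Union>x \<in> verts T. B x) = verts G"
    and Be: "\<And>e. e \<in># edges G \<Longrightarrow> \<exists>x \<in> verts T. e \<subseteq> B x"
    and Bc: "\<And>v. v \<in> verts G \<Longrightarrow> connected_graph (induced_subgraph T {x. v \<in> B x})"
    using td by (auto simp: tree_decomposition_def)
  have mT: "multigraph T" using T by (simp add: tree_def simple_graph_def)
  have finB: "finite (B x)" if "x \<in> verts T" for x
    using BV mg that by (auto simp: multigraph_def intro: finite_subset)
  obtain r where r: "r \<in> verts T" "t \<in> B r" using BV t by blast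
  obtain par dep where rt: "rooting T r (verts T) par dep" using tree_rooting[OF T r(1)] by blast
  define S where "S v = verts T \<inter> {x. v \<in> B x}" for v
  define top where "top v = arg_min dep (\<lambda>x. x \<in> S v)" for v
  have top: "top v \<in> S v" "\<And>x. x \<in> S v \<Longrightarrow> dep (top v) \<le> dep x" if v: "v \<in> verts G" for v
  proof -
    have "\<exists>x. x \<in> S v" using BV v by (auto simp: S_def)
    then show "top v \<in> S v" "\<And>x. x \<in> S v \<Longrightarrow> dep (top v) \<le> dep x"
      unfolding top_def by (auto intro: arg_min_natI arg_min_nat_le)
  qed
  have anc: "(par ^^ (dep y - dep (top v))) y = top v"
    "\<And>i. i \<le> dep y - dep (top v) \<Longrightarrow> (par ^^ i) y \<in> S v"
    if "v \<in> verts G" "y \<in> S v" for v y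
    using connected_ancestor[OF rt mT Bc[OF that(1)], of "top v" y] top[OF that(1)] that(2)
    by (auto simp: S_def)
  define R where "R u v \<longleftrightarrow> (\<exists>x \<in> verts T. u \<in> B x \<and> v \<in> B x)" for u v
  define f where "f v = dep (top v)" for v
  define X where "X v = B (top v) - {v}" for v
  have "R u v" if "adj G u v" for u v
    using Be that unfolding adj_def R_def by blast
  moreover have "f t = 0"
    using top(2)[OF t, of r] r rt by (simp add: f_def S_def rooting_def)
  moreover have "finite (X v) \<and> card (X v) \<le> w \<and> (\<forall>u \<in> X v. \<forall>u' \<in> X v. R u u')"
    if v: "v \<in> verts G" for v
  proof -
    \<comment> \<open>The bag has at most \<open>w + 1\<close> elements and \<open>v\<close> is one
      of them, which leaves at most \<open>w\<close>.\<close>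
    have "top v \<in> verts T" "v \<in> B (top v)" using top(1)[OF v] by (auto simp: S_def)
    then show ?thesis using w[of "top v"] finB[of "top v"] by (auto simp: X_def R_def)
  qed
  moreover have "u \<in> X v"
    if v: "v \<in> verts G" and u: "u \<in> verts G" "u \<noteq> v" "R u v" "f u \<le> f v" for u v
  proof -
    obtain x where x: "x \<in> S u" "x \<in> S v" using u(3) by (auto simp: R_def S_def)
    have "top v = (par ^^ (dep x - f v)) x" using anc(1)[OF v x(2)] by (simp add: f_def)
    \<comment> \<open>From \<open>f u \<le> f v\<close> it follows that
      \<open>dep x - f v \<le> dep x - f u\<close>: the chain reaches \<open>top v\<close> no later
      than \<open>top u\<close>, so it is still inside \<open>S u\<close>.\<close>
    also have "\<dots> \<in> S u" using anc(2)[OF u(1) x(1)] u(4) by (simp add: f_def)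
    finally show ?thesis using u(2) by (auto simp: S_def X_def)
  qed
  ultimately show thesis
    using that[of R f X] unfolding elimination_order_def by blast
qed

text \<open>The decomposition with a single bag makes the set under \<open>LEAST\<close> nonempty,
  so the minimum is attained.\<close>

lemma treewidth_decomposition:
  fixes G :: "'a mgraph"
  assumes mg: "multigraph G"
  shows "\<exists>(T :: nat mgraph) B. tree_decomposition G T B \<and> width T B = treewidth G"
proof -
  let ?T = "\<lparr>verts = {0}, edges = {#}\<rparr> :: nat mgraph"
  have "\<not> cycle ?T vs" for vs
    by (cases vs) (auto simp: cycle_def adj_def)
  then have "tree ?T"
    by (auto simp: tree_def simple_graph_def multigraph_def connected_graph_def)
  then have "tree_decomposition G ?T (\<lambda>_. verts G)"
    using mg by (auto simp: tree_decomposition_def multigraph_def connected_graph_def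
        induced_subgraph_def)
  then have "\<exists>k (T :: nat mgraph) B. tree_decomposition G T B \<and> width T B = k" by blast
  then show ?thesis unfolding treewidth_def by (rule LeastI_ex)
qed

lemma card_bag_le:
  assumes "tree_decomposition G T B" "width T B \<le> w" "x \<in> verts T"
  shows "card (B x) \<le> w + 1"
proof -
  have "finite (verts T)"
    using assms(1) by (auto simp: tree_decomposition_def tree_def simple_graph_def multigraph_def)
  then have "card (B x) \<le> Max ((\<lambda>t. card (B t)) ` verts T)" using assms(3) by simp
  then show ?thesis using assms(2) unfolding width_def by simp
qed

section \<open>Reduction sequences and the elimination of one vertex\<close>

text \<open>The later sequence is the first assumption because the induction runs over it.\<close>

lemma reduces_trans:
  assumes "reduces S d H p' q' K" "reduces S d G p q H"
  shows "reduces S d G (p + p') (q + q') K"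
  using assms
proof (induction rule: reduces.induct)
  case refl
  then show ?case by simp
next
  case (parallel p' q' H H')
  then show ?case by (auto intro: reduces.parallel)
next
  case (star p' q' H c k H')
  then show ?case by (auto intro: reduces.star)
qed

lemma count_mset_set_set_mset: "count (mset_set (set_mset E)) e = (if e \<in># E then 1 else 0)"
  by (simp add: count_mset_set')

text \<open>Each parallel reduction removes one surplus copy of an edge and keeps the set of
  distinct edges, so the number of reductions is the total surplus.\<close>

lemma reduces_simplify:
  "reduces S d \<lparr>verts = V, edges = E\<rparr> (size E - card (set_mset E)) 0
     \<lparr>verts = V, edges = mset_set (set_mset E)\<rparr>"
proof (induction "size E" arbitrary: E)
  case 0
  then show ?case using reduces.refl by simp
next
  case (Suc n)
  show ?case
  proof (cases "\<exists>e. count E e \<ge> 2")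
    case False
    then have "count E e = (if e \<in># E then 1 else 0)" for e
      by (metis One_nat_def count_eq_zero_iff less_2_cases not_le)
    then have "mset_set (set_mset E) = E"
      by (intro multiset_eqI) (simp add: count_mset_set_set_mset)
    moreover from this have "size E = card (set_mset E)" by (metis size_mset_set)
    ultimately show ?thesis using reduces.refl by simp
  next
    case True
    then obtain e where e: "count E e \<ge> 2" by blast
    define F where "F = E - {#e#}"
    have "e \<in># E" using e by (metis count_eq_zero_iff not_numeral_le_zero)
    then have E: "E = add_mset e F" by (simp add: F_def)
    have "count F e > 0" using e by (simp add: F_def)
    then have eF: "e \<in># F" by simp
    then have set: "set_mset F = set_mset E" using E by auto
    have "E - {#e, e#} + {#e#} = F" using E eF by auto
    moreover have "{#e, e#} \<subseteq># E" using E eF by auto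
    ultimately have "parallel_reduction \<lparr>verts = V, edges = E\<rparr> \<lparr>verts = V, edges = F\<rparr>"
      unfolding parallel_reduction_def by (intro exI[of _ e]) simp
    then have 1: "reduces S d \<lparr>verts = V, edges = E\<rparr> 1 0 \<lparr>verts = V, edges = F\<rparr>"
      using reduces.parallel[OF reduces.refl] by fastforce
    have size: "size E = Suc (size F)" using E by simp
    then have n: "n = size F" using Suc.hyps(2) by simp
    have "card (set_mset F) \<le> size F"
      by (metis mset_set_set_mset_msubset size_mset_mono size_mset_set)
    then have "1 + (size F - card (set_mset F)) = size E - card (set_mset E)"
      using size set by simp
    then show ?thesis using reduces_trans[OF Suc.hyps(1)[OF n] 1] set by simp
  qed
qed

text \<open>The map from \<open>v\<close> to \<open>{c, v}\<close> is a bijection from the neighbors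
  of \<open>c\<close> to the edges at \<open>c\<close>, each of multiplicity one. This meets the
  requirement of \<open>star_mesh\<close> that both numbers agree.\<close>

lemma simple_graph_degree:
  assumes "simple_graph G"
  shows "degree G c = card (neighbors G c)"
proof -
  let ?E = "{#e \<in># edges G. c \<in> e#}"
  have mg: "multigraph G" and le: "\<And>e. count (edges G) e \<le> 1"
    using assms by (auto simp: simple_graph_def)
  have "count ?E e = (if e \<in># ?E then 1 else 0)" for e
    using le[of e] count_eq_zero_iff[of "edges G" e] by (cases "count (edges G) e") auto
  then have "mset_set (set_mset ?E) = ?E"
    by (intro multiset_eqI) (simp only: count_mset_set_set_mset)
  then have "degree G c = card (set_mset ?E)" unfolding degree_def by (metis size_mset_set)
  also have "set_mset ?E = (\<lambda>v. {c, v}) ` neighbors G c"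
  proof (intro equalityI subsetI)
    fix e assume e: "e \<in> set_mset ?E"
    then have "card e = 2" using mg by (auto simp: multigraph_def)
    then obtain v where "e = {c, v}" using e by (auto simp: card_2_iff)
    then show "e \<in> (\<lambda>v. {c, v}) ` neighbors G c" using e by (auto simp: neighbors_def adj_def)
  qed (auto simp: neighbors_def adj_def)
  also have "card \<dots> = card (neighbors G c)"
    by (rule card_image) (auto simp: inj_on_def doubleton_eq_iff)
  finally show ?thesis .
qed

text \<open>Counting ordered pairs is enough here. The bound has to vanish for \<open>w = 0\<close>,
  since the final estimate has no additive term.\<close>

lemma card_mesh_le:
  assumes "finite N" "card N \<le> w + 1"
  shows "card {{u, v} | u v. u \<in> N \<and> v \<in> N \<and> u \<noteq> v} \<le> 2 * w\<^sup>2"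
proof -
  have "{{u, v} | u v. u \<in> N \<and> v \<in> N \<and> u \<noteq> v} = (\<lambda>(u, v). {u, v}) ` (SIGMA u:N. N - {u})"
    by auto
  also have "card \<dots> \<le> card (SIGMA u:N. N - {u})"
    using assms(1) by (intro card_image_le) auto
  also have "\<dots> = card N * (card N - 1)" using assms(1) by simp
  also have "\<dots> \<le> (w + 1) * w" using assms(2) by (intro mult_mono) auto
  \<comment> \<open>For \<open>w = 0\<close> both sides are zero; otherwise \<open>w\<close> is at
    most its square.\<close>
  also have "\<dots> \<le> 2 * w\<^sup>2" by (cases w) (auto simp: power2_eq_square)
  finally show ?thesis .
qed

text \<open>Only mesh edges can create a surplus in a simple graph, so their number bounds the
  parallel reductions. Restoring simplicity makes the next vertex eligible for a star-mesh
  transformation.\<close>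

lemma reduces_eliminate:
  assumes sg: "simple_graph G" and c: "c \<in> verts G" "c \<notin> S"
    and deg: "card (neighbors G c) \<le> w + 1"
  shows "\<exists>p H. reduces S (w + 1) G p 1 H \<and> p \<le> 2 * w\<^sup>2 \<and> simple_graph H \<and>
    verts H = verts G - {c} \<and>
    (\<forall>u v. adj H u v \<longrightarrow> adj G u v \<or> u \<in> neighbors G c \<and> v \<in> neighbors G c)"
proof -
  define N where "N = neighbors G c"
  define M where "M = {{u, v} | u v. u \<in> N \<and> v \<in> N \<and> u \<noteq> v}"
  define A where "A = {#e \<in># edges G. c \<notin> e#}"
  define E where "E = A + mset_set M"
  define V where "V = verts G - {c}"
  have mg: "multigraph G" and le: "\<And>e. count (edges G) e \<le> 1"
    using sg by (auto simp: simple_graph_def)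
  have finN: "finite N" and NV: "N \<subseteq> V"
    using finite_neighbors[OF mg] neighbors_subset[OF mg] by (auto simp: N_def V_def)
  have "M \<subseteq> Pow N" by (auto simp: M_def)
  then have finM: "finite M" using finN by (auto intro: finite_subset)
  have "star_mesh (card N) c G \<lparr>verts = V, edges = E\<rparr>"
    unfolding star_mesh_def using c(1) simple_graph_degree[OF sg, of c]
    by (simp add: N_def V_def E_def A_def M_def)
  then have "reduces S (w + 1) G 0 1 \<lparr>verts = V, edges = E\<rparr>"
    using reduces.star[OF reduces.refl] c(2) deg by (fastforce simp: N_def)
  from reduces_trans[OF reduces_simplify this]
  have red: "reduces S (w + 1) G (size E - card (set_mset E)) 1
      \<lparr>verts = V, edges = mset_set (set_mset E)\<rparr>" by simp
  \<comment> \<open>The surviving edges \<open>A\<close> inherit multiplicity at most one, so the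
    surplus in \<open>E\<close> is at most \<open>card M\<close>.\<close>
  have "A \<subseteq># mset_set (set_mset A)"
  proof (rule mset_subset_eqI)
    fix e
    show "count A e \<le> count (mset_set (set_mset A)) e"
      unfolding count_mset_set_set_mset using le[of e] by (auto simp: A_def not_in_iff)
  qed
  then have "size A \<le> card (set_mset A)" by (metis size_mset_mono size_mset_set)
  moreover have "card (set_mset A) \<le> card (set_mset E)" by (rule card_mono) (auto simp: E_def)
  ultimately have "size E - card (set_mset E) \<le> card M" by (simp add: E_def)
  also have "\<dots> \<le> 2 * w\<^sup>2" using card_mesh_le[OF finN] deg by (simp add: M_def N_def)
  finally have p: "size E - card (set_mset E) \<le> 2 * w\<^sup>2" .
  have "e \<subseteq> V \<and> card e = 2" if "e \<in># E" for e
  proof (cases "e \<in> M")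
    case True
    then show ?thesis using NV by (auto simp: M_def)
  next
    case False
    then have "e \<in># A" using that finM by (simp add: E_def)
    then show ?thesis using mg by (auto simp: A_def V_def multigraph_def)
  qed
  then have simple: "simple_graph \<lparr>verts = V, edges = mset_set (set_mset E)\<rparr>"
    using mg by (auto simp: simple_graph_def multigraph_def V_def count_mset_set_set_mset)
  have "adj G u v \<or> u \<in> N \<and> v \<in> N"
    if "adj \<lparr>verts = V, edges = mset_set (set_mset E)\<rparr> u v" for u v
    using that finM by (auto simp: adj_def E_def A_def M_def doubleton_eq_iff)
  then show ?thesis using red p simple unfolding N_def V_def
    by (intro exI conjI) (assumption | simp)+
qed

section \<open>Elimination of all nonterminal vertices\<close>

text \<open>The invariant ignores edges at \<open>s\<close>: eliminating a neighbor of
  \<open>s\<close> may join \<open>s\<close> to vertices with which it shares no bag. Hence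
  \<open>s\<close> can add one to the at most \<open>w\<close> neighbors controlled by
  \<open>X\<close>. The set \<open>V\<close> stays fixed while the graph shrinks.\<close>

lemma reduces_elimination:
  fixes f :: "'a \<Rightarrow> nat"
  assumes elim: "elimination_order V w R f X"
    and t0: "f t = 0"
  shows "simple_graph G \<Longrightarrow> verts G \<subseteq> V \<Longrightarrow> s \<in> verts G \<Longrightarrow> t \<in> verts G \<Longrightarrow>
    (\<And>u v. adj G u v \<Longrightarrow> u \<noteq> s \<Longrightarrow> v \<noteq> s \<Longrightarrow> R u v) \<Longrightarrow>
    \<exists>p H. reduces {s, t} (w + 1) G p (card (verts G - {s, t})) H \<and> simple_graph H \<and>
      verts H = {s, t} \<and> p \<le> 2 * w\<^sup>2 * card (verts G - {s, t})"
proof (induction "card (verts G - {s, t})" arbitrary: G)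
  case 0
  then have "verts G = {s, t}" by (auto simp: simple_graph_def multigraph_def)
  then show ?case using 0(2) reduces.refl by fastforce
next
  case (Suc n)
  have mg: "multigraph G" using Suc.prems(1) by (simp add: simple_graph_def)
  have fin: "finite (verts G)" using mg by (simp add: multigraph_def)
  have "verts G - {s, t} \<noteq> {}" using Suc.hyps(2) by (metis card.empty nat.distinct(1))
  then have "Max (f ` (verts G - {s, t})) \<in> f ` (verts G - {s, t})"
    using fin by (intro Max_in) auto
  then obtain c where c: "c \<in> verts G - {s, t}" and "f c = Max (f ` (verts G - {s, t}))"
    by (metis imageE)
  then have max: "f v \<le> f c" if "v \<in> verts G - {s, t}" for v
    using fin that by simp
  have "c \<in> V" using c Suc.prems(2) by auto
  then have X: "finite (X c) \<and> card (X c) \<le> w \<and>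
      (\<forall>u \<in> V. u \<noteq> c \<and> R u c \<and> f u \<le> f c \<longrightarrow> u \<in> X c) \<and>
      (\<forall>u \<in> X c. \<forall>u' \<in> X c. R u u')"
    using elim unfolding elimination_order_def by blast
  have N: "u \<in> X c" if u: "u \<in> neighbors G c" "u \<noteq> s" for u
  proof -
    have a: "adj G u c" using u by (simp add: neighbors_def adj_sym)
    have "u \<in> verts G" "u \<noteq> c" using adj_verts[OF mg a] by auto
    \<comment> \<open>The maximum ranges over nonterminals only; for \<open>u = t\<close> the
      comparison comes from \<open>f t = 0\<close>.\<close>
    moreover have "f u \<le> f c" using max[of u] u \<open>u \<in> verts G\<close> t0 by (cases "u = t") auto
    moreover have "R u c" using Suc.prems(5)[OF a] u c by auto
    ultimately show ?thesis using X Suc.prems(2) by blast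
  qed
  have "neighbors G c \<subseteq> insert s (X c)" using N by auto
  then have "card (neighbors G c) \<le> card (insert s (X c))"
    using X by (intro card_mono) auto
  also have "\<dots> \<le> w + 1" using X by (simp add: card_insert_if)
  finally obtain p H where H: "reduces {s, t} (w + 1) G p 1 H" "p \<le> 2 * w\<^sup>2" "simple_graph H"
    "verts H = verts G - {c}"
    "\<And>u v. adj H u v \<Longrightarrow> adj G u v \<or> u \<in> neighbors G c \<and> v \<in> neighbors G c"
    using reduces_eliminate[OF Suc.prems(1), of c "{s, t}" w] c by blast
  have n: "n = card (verts H - {s, t})"
  proof -
    have "verts H - {s, t} = verts G - {s, t} - {c}" using H(4) by auto
    then show ?thesis using Suc.hyps(2) c by simp
  qed
  \<comment> \<open>An edge new in \<open>H\<close> that avoids \<open>s\<close> joins two elements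
    of \<open>X c\<close>, and these are related by \<open>R\<close>; for old edges the invariant is
    inherited.\<close>
  have "R u v" if "adj H u v" "u \<noteq> s" "v \<noteq> s" for u v
    using H(5)[OF that(1)] that N Suc.prems(5) X by blast
  then obtain p' K where K: "reduces {s, t} (w + 1) H p' n K" "simple_graph K"
    "verts K = {s, t}" "p' \<le> 2 * w\<^sup>2 * n"
    using Suc.hyps(1)[OF n H(3)] H(4) Suc.prems(2-4) c n by blast
  have "reduces {s, t} (w + 1) G (p + p') (Suc n) K" using reduces_trans[OF K(1) H(1)] by simp
  moreover have "p + p' \<le> 2 * w\<^sup>2 * Suc n" using K(4) H(2) by simp
  ultimately show ?case using K(2,3) Suc.hyps(2) by metis
qed

theorem theorem5:
  "\<exists>C\<^sub>p C\<^sub>s :: nat. \<forall>(G :: 'a mgraph) (s :: 'a) (t :: 'a) (w :: nat) (n :: nat).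
     simple_graph G \<and> card (verts G) = n \<and> treewidth G \<le> w \<and>
     s \<in> verts G \<and> t \<in> verts G \<and> s \<noteq> t \<longrightarrow>
     (\<exists>p q H. reduces {s, t} (w + 1) G p q H \<and>
        verts H = {s, t} \<and> edges H \<subseteq># {#{s, t}#} \<and>
        p \<le> C\<^sub>p * (w ^ 2 * n) \<and> q \<le> C\<^sub>s * n)"
\<comment> \<open>The constant 2 is that of \<open>card_mesh_le\<close>; the constant 1 reflects
  that each nonterminal is deleted exactly once.\<close>
proof (rule exI[of _ 2], rule exI[of _ 1], intro allI impI, elim conjE)
  fix G :: "'a mgraph" and s t :: 'a and w n :: nat
  assume sg: "simple_graph G" and n: "card (verts G) = n" and w: "treewidth G \<le> w"
    and s: "s \<in> verts G" and t: "t \<in> verts G"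
  have mg: "multigraph G" using sg by (simp add: simple_graph_def)
  obtain T :: "nat mgraph" and B where TB: "tree_decomposition G T B" "width T B \<le> w"
    using treewidth_decomposition[OF mg] w by auto
  obtain R and f :: "'a \<Rightarrow> nat" and X where R: "\<And>u v. adj G u v \<Longrightarrow> R u v" and f: "f t = 0"
    and X: "elimination_order (verts G) w R f X"
    using tree_decomposition_elimination[OF TB(1) card_bag_le[OF TB] mg t] by blast
  let ?q = "card (verts G - {s, t})"
  obtain p H where H: "reduces {s, t} (w + 1) G p ?q H" "simple_graph H" "verts H = {s, t}"
    "p \<le> 2 * w\<^sup>2 * ?q"
    using reduces_elimination[OF X f sg order_refl s t] R by blast
  \<comment> \<open>Two vertices admit only one edge, and simplicity bounds its multiplicity by
    one.\<close>
  have "e = {s, t}" if "e \<in># edges H" for e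
  proof -
    have "e \<subseteq> {s, t}" "card e = 2" using H(2,3) that by (auto simp: simple_graph_def multigraph_def)
    then show ?thesis using card_subset_eq[of "{s, t}" e] card_mono[of "{s, t}" e]
      by (auto simp: card_insert_if split: if_splits)
  qed
  then have "count (edges H) e \<le> count {#{s, t}#} e" for e
    using H(2) count_eq_zero_iff[of "edges H" e] by (auto simp: simple_graph_def)
  then have "edges H \<subseteq># {#{s, t}#}" by (rule mset_subset_eqI)
  moreover have q: "?q \<le> n" using n mg by (auto simp: multigraph_def intro: card_mono)
  moreover have "p \<le> 2 * (w ^ 2 * n)"
    using order_trans[OF H(4) mult_le_mono2[OF q]] by (simp only: mult.assoc)
  ultimately show "\<exists>p q H. reduces {s, t} (w + 1) G p q H \<and>
        verts H = {s, t} \<and> edges H \<subseteq># {#{s, t}#} \<and>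
        p \<le> 2 * (w ^ 2 * n) \<and> q \<le> 1 * n"
    using H(1,3) by (metis mult_1)
qed

end
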